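(* Let $G\cong\Gamma(\mathbb{Z}_n)$ be the comaximal graph of order $n$, with independent domination polynomial $D_i(G,x)$. Then the following hold. (i) If $n=p^m$, where $p$ is a prime and $m\ge 1$ is a positive integer, then $D_i(G,x)$ is unimodal if and only if $m=1$ or $m=p=2$, and it is log-concave if and only if $p\neq 3$ and $m\neq 2$. (ii) If $n=p^{n_1}q^{n_2}$, where $p<q$ are primes and $n_1,n_2\ge 1$ are positive integers, then $D_i(G,x)$ is unimodal if and only if $n_1=n_2=1$, $p=2$ and $q=3$. Also, $D_i(G,x)$ is not log-concave if and only if $n_1=n_2=1$, $p=3$ and $q$ is arbitrary; or $n_1=n_2=1$ and $q-p=2$; or $n_1=2$, $n_2=1$, $p=2$ and $q=3$.
   Context: For a commutative ring $R$ with identity $1\ne 0$, the comaximal graph $\Gamma(R)$ is the simple graph with vertex set $R$ in which two distinct vertices $a,b$ are adjacent if and only if $aR+bR=R$. $\mathbb{Z}_n$ is the ring of integers modulo $n$. A non-empty set $S\subseteq V(G)$ is dominating if every vertex of $V(G)\setminus S$ is adjacent to at least one vertex of $S$; it is independent if its elements are pairwise non-adjacent; it is an independent dominating set if it is both. The independent domination polynomial is $D_i(G,x)=\sum_k d_i(G,k)x^k$, where $d_i(G,k)$ is the number of independent dominating sets of $G$ of cardinality $k$. A polynomial $\sum_{i=0}^{N}a_ix^i$ with real coefficients is unimodal if there is an index $t$ with $0\le t\le N$ such that $a_0\le a_1\le\dots\le a_t$ and $a_t\ge a_{t+1}\ge\dots\ge a_N$. It is log-concave if $a_i^2\ge a_{i-1}a_{i+1}$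 for all $1\le i\le N-1$.
   Formalization: In (i), "p≠3 and m≠2" is corrected to "not both p=3 and m=2" (n=3 and n=4 are log-concave); in (ii), the case n_1=n_2=1, p=2, q=3 is added to the non-log-concave list (n=6 gives 2x+x²+x³, where 1 < 2·1). *)

theory Defs
  imports
    "HOL-Number_Theory.Residues"
    "HOL-Computational_Algebra.Polynomial"
    "Graph_Theory.Pair_Digraph"
    "Graph_Theory.Digraph_Isomorphism"
begin

text \<open>
  Finite simple graphs are modelled by \<^locale>\<open>pair_graph\<close>: finite, symmetric, loop-free
  digraphs without parallel arcs.
\<close>

definition comaximal_graph :: "('a, 'b) ring_scheme \<Rightarrow> 'a pair_pre_digraph" where
  "comaximal_graph R =
     \<lparr> pverts = carrier R,
       parcs = {(a, b). a \<in> carrier R \<and> b \<in> carrier R \<and> a \<noteq> b \<and>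
                        PIdl\<^bsub>R\<^esub> a <+>\<^bsub>R\<^esub> PIdl\<^bsub>R\<^esub> b = carrier R} \<rparr>"

definition dominating_set :: "'a pair_pre_digraph \<Rightarrow> 'a set \<Rightarrow> bool" where
  "dominating_set G S \<longleftrightarrow>
     S \<noteq> {} \<and> S \<subseteq> pverts G \<and> (\<forall>v \<in> pverts G - S. \<exists>s \<in> S. v \<rightarrow>\<^bsub>G\<^esub> s)"

definition independent_set :: "'a pair_pre_digraph \<Rightarrow> 'a set \<Rightarrow> bool" where
  "independent_set G S \<longleftrightarrow> S \<subseteq> pverts G \<and> (\<forall>u \<in> S. \<forall>v \<in> S. u \<noteq> v \<longrightarrow> \<not> u \<rightarrow>\<^bsub>G\<^esub> v)"

definition independent_dominating_set :: "'a pair_pre_digraph \<Rightarrow> 'a set \<Rightarrow> bool" where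
  "independent_dominating_set G S \<longleftrightarrow> independent_set G S \<and> dominating_set G S"

definition num_indep_dom_sets :: "'a pair_pre_digraph \<Rightarrow> nat \<Rightarrow> nat" where
  "num_indep_dom_sets G k = card {S. independent_dominating_set G S \<and> card S = k}"

definition indep_dom_poly :: "'a pair_pre_digraph \<Rightarrow> real poly" where
  "indep_dom_poly G = (\<Sum>k \<le> card (pverts G). monom (real (num_indep_dom_sets G k)) k)"

text \<open>
  In the next two definitions the upper index \<open>N\<close> of the coefficient sequence
  \<open>a\<^sub>0, \<dots>, a\<^sub>N\<close> is the degree, and the sequence starts with the constant coefficient.
\<close>

definition unimodal_poly :: "real poly \<Rightarrow> bool" where
  "unimodal_poly P \<longleftrightarrow>
     (\<exists>t \<le> degree P.
        (\<forall>i < t. coeff P i \<le> coeff P (i + 1)) \<and>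
        (\<forall>i. t \<le> i \<and> i < degree P \<longrightarrow> coeff P i \<ge> coeff P (i + 1)))"

definition log_concave_poly :: "real poly \<Rightarrow> bool" where
  "log_concave_poly P \<longleftrightarrow>
     (\<forall>i. 1 \<le> i \<and> i + 1 \<le> degree P \<longrightarrow>
          (coeff P i)\<^sup>2 \<ge> coeff P (i - 1) * coeff P (i + 1))"

end

theory Submission
  imports Defs
begin

text \<open>
  A unit of \<open>\<int>\<^sub>n\<close> is adjacent to every other vertex, and two non-units are non-adjacent iff they
  share a prime factor with \<open>n\<close>. When \<open>n\<close> has only the prime factors \<open>p\<close> and \<open>q\<close>, the independent
  dominating sets are therefore the singletons of units, the multiples of \<open>p\<close> and the multiples of
  \<open>q\<close>, so that \<open>D\<^sub>i = \<phi>(n) x + x\<^bsup>n/q\<^esup> + x\<^bsup>n/p\<^esup>\<close> if \<open>p \<noteq> q\<close>, and \<open>D\<^sub>i = \<phi>(n) x + x\<^bsup>n/p\<^esup>\<close> if \<open>p = q\<close>.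
  With at most three nonzero coefficients, unimodality and log-concavity are decided by the gaps
  between the exponents: a zero between positive coefficients destroys unimodality, and exponents
  at distance two with a zero between them destroy log-concavity.
\<close>

section \<open>Adjacency in the comaximal graph of the integers modulo \<open>m\<close>\<close>

text \<open>The sum of two ideals is the whole ring exactly when it contains 1. By Bezout, applied
  to \<open>a\<close>, \<open>b\<close> and the modulus, this means that the three integers have no
  common factor.\<close>

lemma comaximal_residue_ring:
  fixes m :: int
  assumes "m > 1" "a \<in> {0..<m}" "b \<in> {0..<m}"
  shows "PIdl\<^bsub>residue_ring m\<^esub> a <+>\<^bsub>residue_ring m\<^esub> PIdl\<^bsub>residue_ring m\<^esub> b
           = carrier (residue_ring m) \<longleftrightarrow> coprime (gcd a b) m"
    (is "?I = ?C \<longleftrightarrow> _")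
proof -
  have I: "?I = {(x * a mod m + y * b mod m) mod m |x y. x \<in> {0..<m} \<and> y \<in> {0..<m}}"
    by (auto simp: set_add_def set_mult_def cgenideal_def residue_ring_def)
  have C: "?C = {0..<m}"
    by (auto simp: residue_ring_def)
  show ?thesis
  proof
    assume "?I = ?C"
    then have "1 \<in> ?I" using C assms(1) by simp
    then obtain x y where "(x * a mod m + y * b mod m) mod m = 1" unfolding I by auto
    then have 1: "(x * a + y * b) mod m = 1" by (simp add: mod_simps)
    show "coprime (gcd a b) m"
    proof (rule coprimeI)
      fix d assume "d dvd gcd a b" "d dvd m"
      then have "d dvd (x * a + y * b) mod m" by (simp add: dvd_mod_iff)
      then show "is_unit d" using 1 by simp
    qed
  next
    assume c: "coprime (gcd a b) m"
    obtain u v where uv: "u * gcd a b + v * m = 1" using c by (metis bezout_int coprime_imp_gcd_eq_1)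
    obtain r s where rs: "r * a + s * b = gcd a b" using bezout_int by blast
    have "c \<in> ?I" if "c \<in> {0..<m}" for c
    proof -
      \<comment> \<open>Scaled by \<open>c\<close>, the two Bezout identities combine into a
        combination of \<open>a\<close>, \<open>b\<close> and \<open>m\<close>, whose last term
        vanishes modulo \<open>m\<close>.\<close>
      have "c = c * (u * gcd a b + v * m)" using uv by simp
      also have "\<dots> = (c * u * r) * a + (c * u * s) * b + (c * v) * m"
        by (subst rs[symmetric]) (simp add: algebra_simps)
      finally have "c mod m = ((c * u * r) * a + (c * u * s) * b) mod m"
        by (metis mod_mult_self1)
      then have "c = (((c * u * r) mod m) * a mod m + ((c * u * s) mod m) * b mod m) mod m"
        using that by (simp add: mod_simps)
      moreover have "(c * u * r) mod m \<in> {0..<m}" "(c * u * s) mod m \<in> {0..<m}"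
        using assms(1) by auto
      ultimately show ?thesis unfolding I by blast
    qed
    moreover have "?I \<subseteq> ?C" unfolding I C using assms(1) by auto
    ultimately show "?I = ?C" unfolding C by blast
  qed
qed

lemma pverts_comaximal_residue_ring: "pverts (comaximal_graph (residue_ring m)) = {0..<m}"
  by (auto simp: comaximal_graph_def residue_ring_def)

lemma parcs_comaximal_residue_ring:
  fixes m :: int
  assumes "m > 1"
  shows "(a, b) \<in> parcs (comaximal_graph (residue_ring m)) \<longleftrightarrow>
    a \<in> {0..<m} \<and> b \<in> {0..<m} \<and> a \<noteq> b \<and> coprime (gcd a b) m"
  using comaximal_residue_ring[OF assms] pverts_comaximal_residue_ring[of m]
  by (auto simp: comaximal_graph_def)

section \<open>Invariance of the independent domination polynomial under isomorphism\<close>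

lemma independent_dominating_set_alt:
  "independent_dominating_set G S \<longleftrightarrow>
     S \<noteq> {} \<and> S \<subseteq> pverts G \<and>
     (\<forall>u\<in>S. \<forall>v\<in>S. u \<noteq> v \<longrightarrow> (u, v) \<notin> parcs G) \<and>
     (\<forall>v\<in>pverts G - S. \<exists>s\<in>S. (v, s) \<in> parcs G)"
  by (auto simp: independent_dominating_set_def independent_set_def dominating_set_def)

lemma independent_dominating_set_image:
  assumes f: "inj_on f (pverts G)"
    and H: "pverts H = f ` pverts G"
    and arcs: "\<And>u v. u \<in> pverts G \<Longrightarrow> v \<in> pverts G \<Longrightarrow> (f u, f v) \<in> parcs H \<longleftrightarrow> (u, v) \<in> parcs G"
    and S: "S \<subseteq> pverts G"
  shows "independent_dominating_set H (f ` S) \<longleftrightarrow> independent_dominating_set G S"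
proof -
  have D: "f ` pverts G - f ` S = f ` (pverts G - S)"
    using f S by (simp add: inj_on_image_set_diff)
  have E: "f u = f v \<longleftrightarrow> u = v" if "u \<in> S" "v \<in> S" for u v
    using that f S by (meson inj_on_eq_iff subsetD)
  show ?thesis
    unfolding independent_dominating_set_alt H D
    using S E arcs by (auto simp: image_mono subset_iff) 
qed

text \<open>Taking images under the vertex map is a cardinality-preserving bijection between the
  independent dominating sets. This reduces the theorem to the comaximal graph itself.\<close>

lemma indep_dom_poly_iso:
  assumes "pair_wf_digraph G" "digraph_iso (with_proj G) (with_proj H)"
  shows "indep_dom_poly G = indep_dom_poly H"
proof -
  interpret pair_wf_digraph G by fact
  obtain h where h: "digraph_isomorphism h" and eq: "with_proj H = app_iso h (with_proj G)"
    using assms(2) unfolding digraph_iso_def by blast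
  define f where "f = iso_verts h"
  have f: "inj_on f (pverts G)"
    using digraph_isomorphism_inj_on_verts[OF h] by (simp add: f_def)
  have H: "pverts H = f ` pverts G"
    using arg_cong[OF eq, of verts] by (simp add: f_def)
  \<comment> \<open>Arcs of pair digraphs are vertex pairs, so the vertex component of
    \<open>h\<close> alone determines the arcs of \<open>H\<close>.\<close>
  have P: "parcs H = (\<lambda>(u, v). (f u, f v)) ` parcs G"
    using arcs_ends_app_iso_eq[OF h] unfolding eq[symmetric] f_def by simp
  have arcs: "(f u, f v) \<in> parcs H \<longleftrightarrow> (u, v) \<in> parcs G"
    if "u \<in> pverts G" "v \<in> pverts G" for u v
  proof
    assume "(f u, f v) \<in> parcs H"
    then obtain x y where xy: "(x, y) \<in> parcs G" "f u = f x" "f v = f y"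
      unfolding P by auto
    have "x \<in> pverts G" "y \<in> pverts G"
      using arc_fst_in_verts[OF xy(1)] arc_snd_in_verts[OF xy(1)] by simp_all
    then show "(u, v) \<in> parcs G" using xy that f by (metis inj_onD)
  qed (auto simp: P)
  have "num_indep_dom_sets G k = num_indep_dom_sets H k" for k
  proof -
    let ?F = "\<lambda>K. {S. independent_dominating_set K S \<and> card S = k}"
    have sub: "S \<subseteq> pverts K" if "independent_dominating_set K S" for S and K :: "'c pair_pre_digraph"
      using that by (simp add: independent_dominating_set_alt)
    have img: "independent_dominating_set H (f ` S) \<longleftrightarrow> independent_dominating_set G S"
      "card (f ` S) = card S" if "S \<subseteq> pverts G" for S
      using independent_dominating_set_image[OF f H arcs that] that f
      by (auto intro: card_image inj_on_subset)
    have "?F H = (`) f ` ?F G"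
    proof (intro equalityI subsetI)
      fix T assume "T \<in> ?F H"
      then have T: "independent_dominating_set H T" "card T = k" by auto
      then obtain S where S: "S \<subseteq> pverts G" "T = f ` S"
        using sub[OF T(1)] unfolding H by (meson subset_imageE)
      then show "T \<in> (`) f ` ?F G" using T img by auto
    next
      fix T assume "T \<in> (`) f ` ?F G"
      then obtain S where S: "independent_dominating_set G S" "card S = k" "T = f ` S" by auto
      then show "T \<in> ?F H" using img[OF sub[OF S(1)]] by simp
    qed
    moreover have "inj_on ((`) f) (?F G)"
      using inj_on_image_Pow[OF f] by (rule inj_on_subset) (use sub in auto)
    ultimately show ?thesis
      by (simp add: num_indep_dom_sets_def card_image)
  qed
  moreover have "card (pverts G) = card (pverts H)"
    using f by (simp add: H card_image)
  ultimately show ?thesis by (simp add: indep_dom_poly_def)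
qed

text \<open>No independent dominating set is larger than the vertex set, so the cutoff in the
  defining sum discards nothing.\<close>

lemma coeff_indep_dom_poly:
  assumes "finite (pverts G)"
  shows "coeff (indep_dom_poly G) k = real (num_indep_dom_sets G k)"
proof -
  have "num_indep_dom_sets G k = 0" if "k > card (pverts G)"
  proof -
    have "{S. independent_dominating_set G S \<and> card S = k} = {}"
      using that card_mono[OF assms] by (auto simp: independent_dominating_set_alt not_le[symmetric])
    then show ?thesis by (simp only: num_indep_dom_sets_def card.empty)
  qed
  then show ?thesis
    by (cases "k \<le> card (pverts G)") (simp_all add: indep_dom_poly_def coeff_sum)
qed

section \<open>Unimodality and log-concavity of polynomials with two or three terms\<close>

text \<open>Position \<open>j\<close> lies on the rising or on the falling side of the peak
  \<open>t\<close>. Applied with a zero at \<open>j\<close> between positive coefficients, this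
  refutes unimodality.\<close>

lemma unimodal_poly_no_gap:
  assumes "unimodal_poly P" "i < j" "j < k" "k \<le> degree P"
  shows "coeff P i \<le> coeff P j \<or> coeff P k \<le> coeff P j"
proof -
  obtain t where up: "\<And>i. i < t \<Longrightarrow> coeff P i \<le> coeff P (Suc i)"
    and down: "\<And>i. t \<le> i \<Longrightarrow> i < degree P \<Longrightarrow> coeff P (Suc i) \<le> coeff P i"
    using assms(1) unfolding unimodal_poly_def by auto
  show ?thesis
  proof (cases "j \<le> t")
    case True
    from less_imp_le[OF \<open>i < j\<close>] True have "coeff P i \<le> coeff P j"
      by (induction rule: dec_induct) (auto intro: order_trans[OF _ up])
    then show ?thesis ..
  next
    case False
    from less_imp_le[OF \<open>j < k\<close>] assms(4) have "coeff P k \<le> coeff P j"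
      by (induction rule: dec_induct) (use False in \<open>auto intro: order_trans[OF down]\<close>)
    then show ?thesis ..
  qed
qed

lemma degree_eqI:
  assumes "coeff P N \<noteq> 0" "\<And>k. k > N \<Longrightarrow> coeff P k = 0"
  shows "degree P = N"
  using assms by (intro antisym degree_le le_degree) auto

text \<open>This is the prime power case. A zero separates the exponents once \<open>N\<close> is at
  least 3, and it breaks log-concavity only if they differ by exactly 2. For \<open>N = 1\<close>
  the two terms merge.\<close>

lemma
  fixes c :: real
  assumes c: "c \<ge> 1" and N: "N \<ge> 1"
  defines "P \<equiv> monom c 1 + monom 1 N"
  shows unimodal_poly_monom_add_monom: "unimodal_poly P \<longleftrightarrow> N \<le> 2"
    and log_concave_poly_monom_add_monom: "log_concave_poly P \<longleftrightarrow> N \<noteq> 3"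
proof -
  have co: "coeff P k = (if k = 1 then c else 0) + (if k = N then 1 else 0)" for k
    by (auto simp: P_def)
  have deg: "degree P = N"
    using c N by (intro degree_eqI) (auto simp: co)
  show "unimodal_poly P \<longleftrightarrow> N \<le> 2"
  proof
    assume "unimodal_poly P"
    then show "N \<le> 2"
      using unimodal_poly_no_gap[of P 1 2 N] c by (force simp: co deg)
  next
    assume "N \<le> 2"
    then show "unimodal_poly P"
      unfolding unimodal_poly_def deg co using c N by (intro exI[of _ 1]) auto
  qed
  show "log_concave_poly P \<longleftrightarrow> N \<noteq> 3"
  proof
    assume "log_concave_poly P"
    then show "N \<noteq> 3"
      using c unfolding log_concave_poly_def deg by (auto dest!: spec[of _ 2] simp: co)
  next
    assume "N \<noteq> 3"
    then have "coeff P (i - 1) * coeff P (i + 1) = 0" if "1 \<le> i" "i + 1 \<le> N" for i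
      using that by (auto simp: co)
    then have "coeff P (i - 1) * coeff P (i + 1) \<le> (coeff P i)\<^sup>2" if "1 \<le> i" "i + 1 \<le> N" for i
      using that by (simp only: zero_le_power2)
    then show "log_concave_poly P"
      unfolding log_concave_poly_def deg by simp
  qed
qed

text \<open>Log-concavity fails for three reasons: a zero between exponents 1 and 3, a zero between
  \<open>s\<close> and \<open>s + 2\<close>, or, with exponents 1, 2 and 3, the product
  \<open>c * 1\<close> exceeding the square of the middle coefficient 1.\<close>

lemma
  fixes c :: real
  assumes c: "c \<ge> 1" and st: "2 \<le> s" "s < t"
  defines "P \<equiv> monom c 1 + monom 1 s + monom 1 t"
  shows unimodal_poly_monom_add_monom_add_monom: "unimodal_poly P \<longleftrightarrow> s = 2 \<and> t = 3"
    and log_concave_poly_monom_add_monom_add_monom: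
      "log_concave_poly P \<longleftrightarrow> \<not> (s = 3 \<or> t = s + 2 \<or> s = 2 \<and> t = 3 \<and> c > 1)"
proof -
  have co: "coeff P k = (if k = 1 then c else 0) + (if k = s then 1 else 0) + (if k = t then 1 else 0)" for k
    by (auto simp: P_def)
  have deg: "degree P = t"
    using c st by (intro degree_eqI) (auto simp: co)
  show "unimodal_poly P \<longleftrightarrow> s = 2 \<and> t = 3"
  proof
    assume u: "unimodal_poly P"
    have "s = 2"
      using unimodal_poly_no_gap[OF u, of 1 2 s] c st by (force simp: co deg)
    moreover have "t = 3"
      using unimodal_poly_no_gap[OF u, of 1 3 t] c st \<open>s = 2\<close> by (force simp: co deg)
    ultimately show "s = 2 \<and> t = 3" ..
  next
    assume "s = 2 \<and> t = 3"
    then show "unimodal_poly P"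
      unfolding unimodal_poly_def deg co using c by (intro exI[of _ 1]) auto
  qed
  show "log_concave_poly P \<longleftrightarrow> \<not> (s = 3 \<or> t = s + 2 \<or> s = 2 \<and> t = 3 \<and> c > 1)"
  proof
    assume lc: "log_concave_poly P"
    then have *: "coeff P i * coeff P (i + 2) \<le> (coeff P (i + 1))\<^sup>2" if "i + 2 \<le> t" for i
      using that unfolding log_concave_poly_def deg by (auto dest!: spec[of _ "i + 1"])
    show "\<not> (s = 3 \<or> t = s + 2 \<or> s = 2 \<and> t = 3 \<and> c > 1)"
      \<comment> \<open>Index 1 refutes \<open>s = 3\<close> and the consecutive exponents with
        \<open>c > 1\<close>; index \<open>s\<close> refutes \<open>t = s + 2\<close>.\<close>
      using *[of 1] *[of s] c st by (auto simp: co)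
  next
    assume n: "\<not> (s = 3 \<or> t = s + 2 \<or> s = 2 \<and> t = 3 \<and> c > 1)"
    have "coeff P i * coeff P (i + 2) \<le> (coeff P (i + 1))\<^sup>2" if "i + 2 \<le> t" for i
    proof (cases "s = 2 \<and> t = 3 \<and> i = 1")
      case True
      then show ?thesis using n by (auto simp: co)
    next
      case False
      \<comment> \<open>Nonzero coefficients sit at 1, \<open>s\<close> and \<open>t\<close> only.
        Two of them at distance 2 would need \<open>s = 3\<close>, \<open>t = s + 2\<close>, or
        \<open>t = 3\<close> with \<open>s = 2\<close>, all excluded here.\<close>
      then have "coeff P i * coeff P (i + 2) = 0"
        using n st that by (auto simp: co)
      then show ?thesis by (simp only: zero_le_power2)
    qed
    then show "log_concave_poly P"
      unfolding log_concave_poly_def deg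
      by (metis Suc_diff_1 Suc_eq_plus1 add_2_eq_Suc' less_eq_Suc_le One_nat_def)
  qed
qed

section \<open>Independent dominating sets when the modulus has at most two prime divisors\<close>

text \<open>A non-unit common divisor of \<open>a\<close>, \<open>b\<close> and \<open>m\<close> has
  a prime factor, which can only be \<open>p\<close> or \<open>q\<close>.\<close>

lemma coprime_gcd_iff_two_primes:
  fixes m p q :: int
  assumes "m \<noteq> 0" "prime p" "prime q" "p dvd m" "q dvd m"
    and primes: "\<And>r. prime r \<Longrightarrow> r dvd m \<Longrightarrow> r = p \<or> r = q"
  shows "coprime (gcd a b) m \<longleftrightarrow> \<not> (p dvd a \<and> p dvd b) \<and> \<not> (q dvd a \<and> q dvd b)"
proof
  assume "coprime (gcd a b) m"
  then show "\<not> (p dvd a \<and> p dvd b) \<and> \<not> (q dvd a \<and> q dvd b)"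
    using assms by (metis coprime_common_divisor gcd_greatest not_prime_unit)
next
  assume n: "\<not> (p dvd a \<and> p dvd b) \<and> \<not> (q dvd a \<and> q dvd b)"
  show "coprime (gcd a b) m"
  proof (rule ccontr)
    assume "\<not> coprime (gcd a b) m"
    then have "\<not> is_unit (gcd (gcd a b) m)" by (simp add: coprime_iff_gcd_eq_1)
    moreover have "gcd (gcd a b) m \<noteq> 0" using \<open>m \<noteq> 0\<close> by simp
    ultimately obtain r where "prime r" "r dvd gcd (gcd a b) m"
      using prime_divisor_exists by blast
    then show False using primes[of r] n by auto
  qed
qed

text \<open>The case \<open>p = q\<close> is deliberately allowed: it covers prime powers.\<close>

lemma independent_dominating_sets_comaximal:
  fixes m p q :: int
  assumes m: "m > 1" and p: "prime p" "p dvd m" and q: "prime q" "q dvd m"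
    and primes: "\<And>r. prime r \<Longrightarrow> r dvd m \<Longrightarrow> r = p \<or> r = q"
  defines "M \<equiv> \<lambda>r. {x \<in> {0..<m}. r dvd x}"
  shows "{S. independent_dominating_set (comaximal_graph (residue_ring m)) S} =
    (\<lambda>u. {u}) ` {u \<in> {0..<m}. coprime u m} \<union> {M p, M q}" (is "{S. ?ID S} = ?R")
proof -
  let ?H = "comaximal_graph (residue_ring m)"
  note V = pverts_comaximal_residue_ring[of m]
  have m0: "m \<noteq> 0" using m by simp
  have gcd_iff: "coprime (gcd a b) m \<longleftrightarrow> \<not> (p dvd a \<and> p dvd b) \<and> \<not> (q dvd a \<and> q dvd b)" for a b
    using m0 p(1) q(1) p(2) q(2) primes by (rule coprime_gcd_iff_two_primes)
  have adj: "(a, b) \<in> parcs ?H \<longleftrightarrow> a \<in> {0..<m} \<and> b \<in> {0..<m} \<and> a \<noteq> b \<and>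
      \<not> (p dvd a \<and> p dvd b) \<and> \<not> (q dvd a \<and> q dvd b)" for a b
    unfolding parcs_comaximal_residue_ring[OF m] gcd_iff ..
  have unit: "coprime u m \<longleftrightarrow> \<not> p dvd u \<and> \<not> q dvd u" for u
    using gcd_iff[of u u] by simp
  have ID_M: "?ID (M r)" if r: "r = p \<and> r' = q \<or> r = q \<and> r' = p" for r r'
  proof -
    have zero: "0 \<in> M r" using m by (simp add: M_def)
    \<comment> \<open>One vertex \<open>s\<close> dominates everything outside \<open>M r\<close>:
      an outside vertex misses the factor \<open>r\<close>, and \<open>s\<close> misses the other
      prime \<open>r'\<close>. The witness is \<open>r\<close> itself, or 0 if the primes
      coincide.\<close>
    have ex: "\<exists>s\<in>M r. r' dvd s \<longrightarrow> r = r'"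
    proof (cases "r = r'")
      case False
      have "prime r" "r dvd m" "prime r'" "r' dvd m" using r p q by auto
      have ndvd: "\<not> r' dvd r"
        using False \<open>prime r\<close> \<open>prime r'\<close> primes_dvd_imp_eq by blast
      \<comment> \<open>The witness must be a residue below \<open>m\<close>; it differs from
        \<open>m\<close> because \<open>m\<close> is also divisible by \<open>r'\<close>.\<close>
      have "r \<noteq> m" using ndvd \<open>r' dvd m\<close> by blast
      then have "r < m" using zdvd_imp_le[OF \<open>r dvd m\<close>] m by simp
      then show ?thesis
        using ndvd prime_ge_0_int[OF \<open>prime r\<close>] by (intro bexI[of _ r]) (auto simp: M_def)
    qed (use zero in blast)
    show ?thesis
      unfolding independent_dominating_set_alt V adj
    proof (intro conjI ballI)
      show "M r \<noteq> {}" using zero by blast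
      show "M r \<subseteq> {0..<m}" by (auto simp: M_def)
    next
      fix v assume v: "v \<in> {0..<m} - M r"
      then have "\<not> r dvd v" by (auto simp: M_def)
      from ex obtain s where s: "s \<in> M r" "r' dvd s \<longrightarrow> r = r'" by blast
      have "v \<noteq> s" using v s by blast
      then show "\<exists>s\<in>M r. v \<in> {0..<m} \<and> s \<in> {0..<m} \<and> v \<noteq> s \<and>
          \<not> (p dvd v \<and> p dvd s) \<and> \<not> (q dvd v \<and> q dvd s)"
        using v s r \<open>\<not> r dvd v\<close> by (intro bexI[of _ s]) (auto simp: M_def)
    qed (use r in \<open>auto simp: M_def\<close>)
  qed
  have ID_unit: "?ID {u}" if "u \<in> {0..<m}" "coprime u m" for u
    using that unfolding independent_dominating_set_alt V adj unit by auto
  have "S \<in> ?R" if "?ID S" for S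
  proof -
    from that have S: "S \<noteq> {}" "S \<subseteq> {0..<m}"
      and ind: "\<And>u v. u \<in> S \<Longrightarrow> v \<in> S \<Longrightarrow> u \<noteq> v \<Longrightarrow> p dvd u \<and> p dvd v \<or> q dvd u \<and> q dvd v"
      and dom: "\<And>v. v \<in> {0..<m} - S \<Longrightarrow> \<exists>s\<in>S. \<not> (p dvd v \<and> p dvd s) \<and> \<not> (q dvd v \<and> q dvd s)"
      unfolding independent_dominating_set_alt V adj by blast+
    show ?thesis
    proof (cases "\<exists>u\<in>S. coprime u m")
      case True
      then obtain u where u: "u \<in> S" "coprime u m" by blast
      then have "S = {u}" using ind unit by blast
      then show ?thesis using u S by auto
    next
      case False
      then have nu: "p dvd x \<or> q dvd x" if "x \<in> S" for x
        using that unit by blast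
      have "S \<subseteq> M p \<or> S \<subseteq> M q"
      proof (rule ccontr)
        assume "\<not> ?thesis"
        then obtain x y where xy: "x \<in> S" "\<not> p dvd x" "y \<in> S" "\<not> q dvd y"
          using S unfolding M_def by blast
        \<comment> \<open>Here \<open>x\<close> is a multiple of \<open>q\<close> only and
          \<open>y\<close> of \<open>p\<close> only, so they are distinct and adjacent.\<close>
        then show False using nu ind by blast
      qed
      \<comment> \<open>A multiple of \<open>r\<close> outside \<open>S\<close> would share the
        factor \<open>r\<close> with all of \<open>S\<close> and stay undominated.\<close>
      moreover have "S = M r" if "S \<subseteq> M r" "r = p \<or> r = q" for r
        using that dom unfolding M_def by blast
      ultimately show ?thesis by blast
    qed
  qed
  then show ?thesis using ID_M[of p q] ID_M[of q p] ID_unit by blast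
qed

section \<open>Sizes of the independent dominating sets and the resulting polynomial\<close>

lemma card_multiples_below:
  fixes d m :: int
  assumes "d > 0" "m \<ge> 0" "d dvd m"
  shows "card {x \<in> {0..<m}. d dvd x} = nat (m div d)"
proof -
  obtain k where k: "m = d * k" using assms(3) by blast
  have "{x \<in> {0..<m}. d dvd x} = (*) d ` {0..<k}"
    using assms(1) by (auto simp: k zero_le_mult_iff)
  moreover have "inj_on ((*) d) {0..<k}" using assms(1) by (auto intro: inj_onI)
  ultimately show ?thesis using assms(1) by (simp add: k card_image)
qed

lemma indep_dom_poly_comaximal:
  fixes n p q :: nat
  assumes n: "n > 1" and p: "prime p" "p dvd n" and q: "prime q" "q dvd n"
    and primes: "\<And>r. prime r \<Longrightarrow> r dvd n \<Longrightarrow> r = p \<or> r = q"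
  defines "U \<equiv> {u \<in> {0..<int n}. coprime u (int n)}"
  shows "indep_dom_poly (comaximal_graph (residue_ring (int n))) =
    (if p = q then monom (real (card U)) 1 + monom 1 (n div p)
     else monom (real (card U)) 1 + monom 1 (n div q) + monom 1 (n div p))"
proof -
  let ?H = "comaximal_graph (residue_ring (int n))"
  define M where "M = (\<lambda>r. {x \<in> {0..<int n}. r dvd x})"
  have primes': "r = int p \<or> r = int q" if "prime r" "r dvd int n" for r
  proof -
    obtain k where k: "r = int k" using \<open>prime r\<close> by (metis nonneg_int_cases prime_ge_0_int)
    then show ?thesis using that primes[of k] by simp
  qed
  have F: "{S. independent_dominating_set ?H S} = (\<lambda>u. {u}) ` U \<union> {M (int p), M (int q)}"
    unfolding U_def M_def
    by (rule independent_dominating_sets_comaximal) (use assms primes' in auto)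
  have cM: "card (M (int r)) = n div r" if "r > 0" "r dvd n" for r
    unfolding M_def using that by (subst card_multiples_below) (auto simp: zdiv_int[symmetric])
  have cp: "card (M (int p)) = n div p" and cq: "card (M (int q)) = n div q"
    using p q by (auto intro!: cM prime_gt_0_nat)
  have zero: "0 \<in> M r" for r using n by (simp add: M_def)
  have "finite U" unfolding U_def by (rule finite_subset[of _ "{0..<int n}"]) auto
  have "0 \<notin> U" using n by (simp add: U_def)
  have num: "num_indep_dom_sets ?H k = (if k = 1 then card U else 0) +
      card {S \<in> {M (int p), M (int q)}. card S = k}" for k
  proof -
    let ?A = "if k = 1 then (\<lambda>u. {u}) ` U else {}" and ?B = "{S \<in> {M (int p), M (int q)}. card S = k}"
    have "{S. independent_dominating_set ?H S \<and> card S = k} =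
        {S. independent_dominating_set ?H S} \<inter> {S. card S = k}" by blast
    also have "\<dots> = ?A \<union> ?B" unfolding F by auto
    also have "card \<dots> = card ?A + card ?B"
    proof (rule card_Un_disjoint)
      \<comment> \<open>Zero lies in every set of multiples and is not a unit. This matters in
        degree 1, since \<open>M (int p)\<close> is the singleton of 0 when
        \<open>n = p\<close>.\<close>
      have "M (int r) \<notin> (\<lambda>u. {u}) ` U" for r
        using zero[of "int r"] \<open>0 \<notin> U\<close> by auto
      then show "?A \<inter> ?B = {}" by auto
    qed (use \<open>finite U\<close> in auto)
    also have "card ?A = (if k = 1 then card U else 0)"
      by (auto simp: card_image)
    finally show ?thesis by (simp add: num_indep_dom_sets_def)
  qed
  have B: "card {S \<in> {M (int p), M (int q)}. card S = k} =
      (if k = n div p then 1 else 0) + (if p \<noteq> q \<and> k = n div q then 1 else 0)" for k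
  proof (cases "p = q")
    case True
    then have "{S \<in> {M (int p), M (int q)}. card S = k} = (if k = n div p then {M (int p)} else {})"
      using cp by auto
    then show ?thesis using True by simp
  next
    case False
    have "n div p \<noteq> n div q"
      using False n p(2) q(2) by (metis dvd_div_mult_self mult_left_cancel mult_0 not_one_less_zero)
    moreover have "M (int p) \<noteq> M (int q)" using calculation cp cq by metis
    moreover have "{S \<in> {M (int p), M (int q)}. card S = k} =
        (if k = n div p then {M (int p)} else {}) \<union> (if k = n div q then {M (int q)} else {})"
      using cp cq by auto
    ultimately show ?thesis using False by auto
  qed
  have "finite (pverts ?H)" by (simp add: pverts_comaximal_residue_ring)
  note co = coeff_indep_dom_poly[OF this, unfolded num B]
  show ?thesis
  proof (cases "p = q")
    case True
    then show ?thesis by (intro poly_eqI) (simp add: co)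
  next
    case False
    then show ?thesis by (intro poly_eqI) (simp add: co)
  qed
qed

lemma card_coprime_residues:
  fixes n :: nat
  assumes "n \<ge> 2"
  defines "U \<equiv> {u \<in> {0..<int n}. coprime u (int n)}"
  shows "card U \<ge> 1" "n \<ge> 3 \<Longrightarrow> card U \<ge> 2"
proof -
  have fin: "finite U" unfolding U_def by (rule finite_subset[of _ "{0..<int n}"]) auto
  have "{1} \<subseteq> U" using assms by (auto simp: U_def)
  from card_mono[OF fin this] show "card U \<ge> 1" by simp
  have "coprime (int n - 1) (int n)" by (rule coprime_diff_one_left)
  then have "{1, int n - 1} \<subseteq> U" using assms by (auto simp: U_def)
  from card_mono[OF fin this] show "card U \<ge> 2" if "n \<ge> 3" using that by (simp split: if_splits)
qed

lemma prime_power_eq_prime_iff: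
  fixes p r :: nat
  assumes "prime p" "prime r"
  shows "p ^ k = r \<longleftrightarrow> p = r \<and> k = 1"
  using assms by (metis One_nat_def power_one_right prime_power_eq_one_iff prime_power_iff)

theorem theorem2p8:
  fixes G :: "'a pair_pre_digraph" and n :: nat
  assumes "n \<ge> 2"
    and "pair_graph G"
    and "digraph_iso (with_proj G) (with_proj (comaximal_graph (residue_ring (int n))))"
  shows
    "(\<forall>p m :: nat. prime p \<and> m \<ge> 1 \<and> n = p ^ m \<longrightarrow>
        (unimodal_poly (indep_dom_poly G) \<longleftrightarrow> m = 1 \<or> (m = 2 \<and> p = 2)) \<and>
        (log_concave_poly (indep_dom_poly G) \<longleftrightarrow> \<not> (p = 3 \<and> m = 2)))
     \<and>
     (\<forall>p q n1 n2 :: nat.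
        prime p \<and> prime q \<and> p < q \<and> n1 \<ge> 1 \<and> n2 \<ge> 1 \<and> n = p ^ n1 * q ^ n2 \<longrightarrow>
        (unimodal_poly (indep_dom_poly G) \<longleftrightarrow> n1 = 1 \<and> n2 = 1 \<and> p = 2 \<and> q = 3) \<and>
        (\<not> log_concave_poly (indep_dom_poly G) \<longleftrightarrow>
            (n1 = 1 \<and> n2 = 1 \<and> p = 3) \<or>
            (n1 = 1 \<and> n2 = 1 \<and> q - p = 2) \<or>
            (n1 = 2 \<and> n2 = 1 \<and> p = 2 \<and> q = 3) \<or>
            (n1 = 1 \<and> n2 = 1 \<and> p = 2 \<and> q = 3)))"
proof -
  define c where "c = real (card {u \<in> {0..<int n}. coprime u (int n)})"
  have c: "c \<ge> 1" "n \<ge> 3 \<Longrightarrow> c > 1"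
    using card_coprime_residues[OF assms(1)] by (auto simp: c_def)
  have "pair_wf_digraph G"
  proof -
    interpret pair_graph G by fact
    show ?thesis by unfold_locales
  qed
  from indep_dom_poly_iso[OF this assms(3)]
  have G: "indep_dom_poly G = indep_dom_poly (comaximal_graph (residue_ring (int n)))" .
  have prime_power: "(unimodal_poly (indep_dom_poly G) \<longleftrightarrow> m = 1 \<or> (m = 2 \<and> p = 2)) \<and>
        (log_concave_poly (indep_dom_poly G) \<longleftrightarrow> \<not> (p = 3 \<and> m = 2))"
    if "prime p" "m \<ge> 1" "n = p ^ m" for p m :: nat
  proof -
    obtain k where m: "m = Suc k" using \<open>m \<ge> 1\<close> by (cases m) auto
    have primes: "r = p" if "prime r" "r dvd n" for r
      using that \<open>n = p ^ m\<close> \<open>prime p\<close> by (metis prime_dvd_power primes_dvd_imp_eq)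
    have P: "indep_dom_poly G = monom c 1 + monom 1 (p ^ k)"
      unfolding G c_def
      by (subst indep_dom_poly_comaximal[of n p p])
        (use that assms(1) m in \<open>auto dest: primes simp: prime_gt_0_nat\<close>)
    have "p > 1" using \<open>prime p\<close> by (rule prime_gt_1_nat)
    have "p ^ k \<le> 2 \<longleftrightarrow> k = 0 \<or> k = 1 \<and> p = 2"
    proof -
      have "p ^ k \<le> 2 \<longleftrightarrow> p ^ k = 1 \<or> p ^ k = 2"
        using \<open>p > 1\<close> by (auto simp: le_Suc_eq numeral_2_eq_2)
      then show ?thesis
        using \<open>p > 1\<close> prime_power_eq_prime_iff[OF \<open>prime p\<close> two_is_prime_nat, of k] by auto
    qed
    moreover have "p ^ k = 3 \<longleftrightarrow> p = 3 \<and> k = 1"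
      using prime_power_eq_prime_iff[OF \<open>prime p\<close>, of 3 k] by simp
    moreover have "p ^ k \<ge> 1" using \<open>p > 1\<close> by simp
    ultimately show ?thesis
      unfolding P using unimodal_poly_monom_add_monom log_concave_poly_monom_add_monom c(1)
      by (simp add: m)
  qed
  have two_primes: "(unimodal_poly (indep_dom_poly G) \<longleftrightarrow> n1 = 1 \<and> n2 = 1 \<and> p = 2 \<and> q = 3) \<and>
        (\<not> log_concave_poly (indep_dom_poly G) \<longleftrightarrow>
            (n1 = 1 \<and> n2 = 1 \<and> p = 3) \<or>
            (n1 = 1 \<and> n2 = 1 \<and> q - p = 2) \<or>
            (n1 = 2 \<and> n2 = 1 \<and> p = 2 \<and> q = 3) \<or>
            (n1 = 1 \<and> n2 = 1 \<and> p = 2 \<and> q = 3))"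
    if "prime p" "prime q" "p < q" "n1 \<ge> 1" "n2 \<ge> 1" "n = p ^ n1 * q ^ n2" for p q n1 n2 :: nat
  proof -
    obtain a b where ab: "n1 = Suc a" "n2 = Suc b"
      using \<open>n1 \<ge> 1\<close> \<open>n2 \<ge> 1\<close> by (metis Suc_le_D One_nat_def)
    define l where "l = p ^ a * q ^ b"
    have n: "n = p * q * l" using that ab by (simp add: l_def)
    have p: "p \<ge> 2" and q: "q \<ge> 3" using that prime_ge_2_nat[of p] by auto
    have "l \<ge> 1" using p q by (simp add: l_def)
    have div: "n div q = p * l" "n div p = q * l" using p q by (auto simp: n)
    have primes: "r = p \<or> r = q" if "prime r" "r dvd n" for r
      using that \<open>n = p ^ n1 * q ^ n2\<close> \<open>prime p\<close> \<open>prime q\<close>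
      by (metis prime_dvd_mult_iff prime_dvd_power primes_dvd_imp_eq)
    have P: "indep_dom_poly G = monom c 1 + monom 1 (p * l) + monom 1 (q * l)"
      unfolding G c_def
      by (subst indep_dom_poly_comaximal[of n p q])
        (use that assms(1) primes div in \<open>auto simp: n\<close>)
    have l1: "l = 1 \<longleftrightarrow> a = 0 \<and> b = 0"
      using p q by (auto simp: l_def)
    have prod_prime: "x * l = r \<longleftrightarrow> x = r \<and> l = 1" if "prime r" "x > 1" for x r
      using that prime_product[of x l] by auto
    have s2: "p * l = 2 \<longleftrightarrow> p = 2 \<and> l = 1" and s3: "p * l = 3 \<longleftrightarrow> p = 3 \<and> l = 1"
      using p by (auto simp: prod_prime)
    have t3: "q * l = 3 \<longleftrightarrow> q = 3 \<and> l = 1"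
      using q by (auto simp: prod_prime)
    have "q * l = p * l + 2 \<longleftrightarrow> (q - p) * l = 2"
      using \<open>p < q\<close> by (auto simp: diff_mult_distrib)
    also have "\<dots> \<longleftrightarrow> q - p = 2 \<and> l = 1 \<or> q - p = 1 \<and> l = 2"
    proof (cases "q - p = 1")
      case False
      then have "q - p > 1" using \<open>p < q\<close> by linarith
      then show ?thesis using prod_prime[of 2 "q - p"] by auto
    qed auto
    also have "q - p = 1 \<and> l = 2 \<longleftrightarrow> a = 1 \<and> b = 0 \<and> p = 2 \<and> q = 3"
    proof
      assume *: "q - p = 1 \<and> l = 2"
      then have "q = Suc p" using \<open>p < q\<close> by linarith
      have "even p" using \<open>q = Suc p\<close> prime_odd_nat[OF \<open>prime q\<close>] q by simp
      then have "p = 2" using prime_odd_nat[OF \<open>prime p\<close>] p by force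
      then have "2 ^ a * 3 ^ b = (2::nat)" "q = 3" using * \<open>q = Suc p\<close> by (auto simp: l_def)
      moreover have "b = 0"
      proof (rule ccontr)
        assume "b \<noteq> 0"
        then have "3 dvd 2 ^ a * (3::nat) ^ b" by simp
        then show False using calculation by (simp del: power_eq_0_iff)
      qed
      ultimately have "2 ^ a = (2::nat) ^ 1" by simp
      then have "a = 1" by (simp only: power_inject_exp)
      then show "a = 1 \<and> b = 0 \<and> p = 2 \<and> q = 3" using \<open>b = 0\<close> \<open>p = 2\<close> \<open>q = 3\<close> by simp
    qed (simp add: l_def)
    finally have t: "q * l = p * l + 2 \<longleftrightarrow>
      q - p = 2 \<and> l = 1 \<or> a = 1 \<and> b = 0 \<and> p = 2 \<and> q = 3" .
    have "n \<ge> 2 * 3 * 1" unfolding n using p q \<open>l \<ge> 1\<close> by (intro mult_le_mono)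
    then have "n \<ge> 3" by simp
    then have c1: "c > 1" by (rule c(2))
    have st: "2 \<le> p * l" "p * l < q * l"
      using p \<open>l \<ge> 1\<close> \<open>p < q\<close> by (auto intro: order_trans[OF p])
    show ?thesis
      unfolding P unimodal_poly_monom_add_monom_add_monom[OF c(1) st]
        log_concave_poly_monom_add_monom_add_monom[OF c(1) st] s2 s3 t3 t l1 ab
      using c1 by auto
  qed
  show ?thesis
    by (rule conjI; intro allI impI; elim conjE; ((rule prime_power | rule two_primes); assumption))
qed

end
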